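(* Let $P=(p_1,\dots,p_n)$ be a real pattern with break regions $[l_k,r_k]$ ($1\le k\le b-1$) and thresholds $\varepsilon_1,\dots,\varepsilon_b\ge0$, and let $C=(c_1,\dots,c_n)$ be a real sequence. The adaptive post-processing procedure (described in the context) reports $C$ if and only if $C$ is a fine-grained matching result of $P$. Moreover, the procedure can be carried out in $O(n)$ time (arithmetic operations and comparisons on real numbers) in the worst case.
   Context: For equal-length real sequences, $ED_{norm}(X,Y)=\sqrt{\frac1m\sum_{i=1}^m|x_i-y_i|^2}$, where $m$ is their common length. $X[i:j]$ denotes $(x_i,\dots,x_j)$. Break regions: the number of segments is $b\ge1$; $[l_k,r_k]$, $1\le k\le b-1$, are integer intervals that are pairwise non-overlapping and ordered, contained in $[1,n-1]$, i.e. $1\le l_1\le r_1<l_2\le r_2<\dots<l_{b-1}\le r_{b-1}\le n-1$. A segmentation is a choice of integers (breakpoints) $bp_k\in[l_k,r_k]$ for $1\le k\le b-1$, with $bp_0=0$ and $bp_b=n$. $C$ is a fine-grained matching result of $P$ if there exists a segmentation such that for every $k\in\{1,\dots,b\}$, $ED_{norm}(P[bp_{k-1}+1:bp_k],C[bp_{k-1}+1:bp_k])\le\varepsilon_k$. Notation: $\delta(i,\varepsilon)=|c_i-p_i|^2-\varepsilon^2$ and $\Delta(l,r,\varepsilon)=\sum_{i=l}^r\delta(i,\varepsilon)$ for $1\le l\le r\le n$. Adaptive post-processing procedure: set $bp^{opt}_0=0$. For $k=1,\dots,b-1$ in turn: compute $PS_k=\{j\in[l_k,r_k] : \Delta(bp^{opt}_{k-1}+1,j,\varepsilon_k)\le0\}$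 (by accumulating $\delta(\cdot,\varepsilon_k)$ from left to right); if $PS_k=\emptyset$, stop without reporting $C$; otherwise choose $bp^{opt}_k\in\arg\min_{j\in PS_k}\Delta(j+1,r_k+1,\varepsilon_{k+1})$ (by accumulating $\delta(\cdot,\varepsilon_{k+1})$ from right to left). Finally, report $C$ if and only if all $bp^{opt}_1,\dots,bp^{opt}_{b-1}$ were found and $ED_{norm}(C[bp^{opt}_{b-1}+1:n],P[bp^{opt}_{b-1}+1:n])\le\varepsilon_b$. *)

theory Defs
  imports Complex_Main
begin

section \<open>Patterns with break regions and fine-grained matching\<close>

text \<open>
  A sequence of length \<open>n\<close> is a function on \<open>nat\<close> of which only the entries \<open>1, ..., n\<close> matter.
  Likewise, the break regions \<open>[lo k, hi k]\<close> are indexed by \<open>k = 1, ..., nseg - 1\<close> and the thresholds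
  \<open>thr k\<close> by \<open>k = 1, ..., nseg\<close>.
\<close>

record fg_pattern =
  len :: nat
  val :: "nat \<Rightarrow> real"
  nseg :: nat
  lo :: "nat \<Rightarrow> nat"
  hi :: "nat \<Rightarrow> nat"
  thr :: "nat \<Rightarrow> real"

definition valid_pattern :: "fg_pattern \<Rightarrow> bool" where
  "valid_pattern P \<longleftrightarrow>
     1 \<le> len P \<and> 1 \<le> nseg P \<and>
     (\<forall>k. 1 \<le> k \<and> k < nseg P \<longrightarrow> 1 \<le> lo P k \<and> lo P k \<le> hi P k \<and> hi P k \<le> len P - 1) \<and>
     (\<forall>k. 1 \<le> k \<and> k + 1 < nseg P \<longrightarrow> hi P k < lo P (k + 1)) \<and>
     (\<forall>k. 1 \<le> k \<and> k \<le> nseg P \<longrightarrow> 0 \<le> thr P k)"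

definition slice :: "(nat \<Rightarrow> 'a) \<Rightarrow> nat \<Rightarrow> nat \<Rightarrow> 'a list" where
  "slice x i j = map x [i..<j + 1]"

text \<open>Only used for lists of equal, nonzero length.\<close>

definition ED_norm :: "real list \<Rightarrow> real list \<Rightarrow> real" where
  "ED_norm X Y = sqrt (1 / real (length X) * (\<Sum>i<length X. \<bar>X ! i - Y ! i\<bar>\<^sup>2))"

definition segmentation :: "fg_pattern \<Rightarrow> (nat \<Rightarrow> nat) \<Rightarrow> bool" where
  "segmentation P bp \<longleftrightarrow>
     bp 0 = 0 \<and> bp (nseg P) = len P \<and>
     (\<forall>k. 1 \<le> k \<and> k < nseg P \<longrightarrow> bp k \<in> {lo P k..hi P k})"

definition fine_grained_match :: "fg_pattern \<Rightarrow> (nat \<Rightarrow> real) \<Rightarrow> bool" where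
  "fine_grained_match P c \<longleftrightarrow>
     (\<exists>bp. segmentation P bp \<and>
        (\<forall>k\<in>{1..nseg P}.
           ED_norm (slice (val P) (bp (k - 1) + 1) (bp k)) (slice c (bp (k - 1) + 1) (bp k))
             \<le> thr P k))"


section \<open>The adaptive post-processing procedure\<close>

definition delta :: "fg_pattern \<Rightarrow> (nat \<Rightarrow> real) \<Rightarrow> nat \<Rightarrow> real \<Rightarrow> real" where
  "delta P c i e = \<bar>c i - val P i\<bar>\<^sup>2 - e\<^sup>2"

definition Delta :: "fg_pattern \<Rightarrow> (nat \<Rightarrow> real) \<Rightarrow> nat \<Rightarrow> nat \<Rightarrow> real \<Rightarrow> real" where
  "Delta P c l r e = (\<Sum>i=l..r. delta P c i e)"

definition PS :: "fg_pattern \<Rightarrow> (nat \<Rightarrow> real) \<Rightarrow> nat \<Rightarrow> nat \<Rightarrow> nat set" where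
  "PS P c k prev = {j \<in> {lo P k..hi P k}. Delta P c (prev + 1) j (thr P k) \<le> 0}"

text \<open>
  \<open>proc_from P c k prev bs rep\<close>: when the procedure enters round \<open>k\<close> having chosen \<open>prev\<close> as
  breakpoint \<open>k - 1\<close>, it may choose the further breakpoints \<open>bs\<close> and then stop, reporting \<open>c\<close> iff
  \<open>rep\<close>. This is a relation because ties in the arg min may be broken arbitrarily.
\<close>

inductive proc_from ::
    "fg_pattern \<Rightarrow> (nat \<Rightarrow> real) \<Rightarrow> nat \<Rightarrow> nat \<Rightarrow> nat list \<Rightarrow> bool \<Rightarrow> bool"
  for P c where
  stop: "k < nseg P \<Longrightarrow> PS P c k prev = {} \<Longrightarrow> proc_from P c k prev [] False"
| choose: "k < nseg P \<Longrightarrow>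
    is_arg_min (\<lambda>j. Delta P c (j + 1) (hi P k + 1) (thr P (k + 1))) (\<lambda>j. j \<in> PS P c k prev) j \<Longrightarrow>
    proc_from P c (k + 1) j bs rep \<Longrightarrow>
    proc_from P c k prev (j # bs) rep"
| finish: "k = nseg P \<Longrightarrow>
    proc_from P c k prev []
      (ED_norm (slice c (prev + 1) (len P)) (slice (val P) (prev + 1) (len P)) \<le> thr P k)"

definition proc_run :: "fg_pattern \<Rightarrow> (nat \<Rightarrow> real) \<Rightarrow> nat list \<Rightarrow> bool \<Rightarrow> bool" where
  "proc_run P c bs rep \<longleftrightarrow> proc_from P c 1 0 bs rep"


section \<open>Running time: a real random access machine\<close>

text \<open>
  Structured programs over a memory of named arrays of natural numbers and named arrays of real
  numbers; a scalar is cell \<open>0\<close> of an array. Reals admit exact arithmetic and comparison and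
  integer literals, but no rounding. Naturals have addition, truncated subtraction and comparison.
  Every literal, memory access, arithmetic operation, comparison, Boolean connective, store and
  branch takes one unit of time; in particular the time bounds the number of arithmetic operations
  and comparisons on reals.
\<close>

record memory =
  nmem :: "string \<Rightarrow> nat \<Rightarrow> nat"
  rmem :: "string \<Rightarrow> nat \<Rightarrow> real"

datatype nexp =
    NNum nat
  | NCell string nexp
  | NPlus nexp nexp
  | NMinus nexp nexp

datatype rexp =
    RNum int
  | RCell string nexp
  | RPlus rexp rexp
  | RMinus rexp rexp
  | RTimes rexp rexp
  | RDivide rexp rexp

datatype bexp =
    NLe nexp nexp
  | RLe rexp rexp
  | Neg bexp
  | Conj bexp bexp

datatype prog =
    Skip
  | NStore string nexp nexp
  | RStore string nexp rexp
  | Seq prog prog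
  | Cond bexp prog prog
  | While bexp prog

fun nval :: "nexp \<Rightarrow> memory \<Rightarrow> nat" where
  "nval (NNum m) s = m"
| "nval (NCell a i) s = nmem s a (nval i s)"
| "nval (NPlus e f) s = nval e s + nval f s"
| "nval (NMinus e f) s = nval e s - nval f s"

fun rval :: "rexp \<Rightarrow> memory \<Rightarrow> real" where
  "rval (RNum z) s = of_int z"
| "rval (RCell a i) s = rmem s a (nval i s)"
| "rval (RPlus e f) s = rval e s + rval f s"
| "rval (RMinus e f) s = rval e s - rval f s"
| "rval (RTimes e f) s = rval e s * rval f s"
| "rval (RDivide e f) s = rval e s / rval f s"

fun bval :: "bexp \<Rightarrow> memory \<Rightarrow> bool" where
  "bval (NLe e f) s \<longleftrightarrow> nval e s \<le> nval f s"
| "bval (RLe e f) s \<longleftrightarrow> rval e s \<le> rval f s"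
| "bval (Neg b) s \<longleftrightarrow> \<not> bval b s"
| "bval (Conj b d) s \<longleftrightarrow> bval b s \<and> bval d s"

fun ntime :: "nexp \<Rightarrow> nat" where
  "ntime (NNum m) = 1"
| "ntime (NCell a i) = ntime i + 1"
| "ntime (NPlus e f) = ntime e + ntime f + 1"
| "ntime (NMinus e f) = ntime e + ntime f + 1"

fun rtime :: "rexp \<Rightarrow> nat" where
  "rtime (RNum z) = 1"
| "rtime (RCell a i) = ntime i + 1"
| "rtime (RPlus e f) = rtime e + rtime f + 1"
| "rtime (RMinus e f) = rtime e + rtime f + 1"
| "rtime (RTimes e f) = rtime e + rtime f + 1"
| "rtime (RDivide e f) = rtime e + rtime f + 1"

fun btime :: "bexp \<Rightarrow> nat" where
  "btime (NLe e f) = ntime e + ntime f + 1"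
| "btime (RLe e f) = rtime e + rtime f + 1"
| "btime (Neg b) = btime b + 1"
| "btime (Conj b d) = btime b + btime d + 1"

text \<open>\<open>exec q s t s'\<close>: started in memory \<open>s\<close>, program \<open>q\<close> halts after time \<open>t\<close> in memory \<open>s'\<close>.\<close>

inductive exec :: "prog \<Rightarrow> memory \<Rightarrow> nat \<Rightarrow> memory \<Rightarrow> bool" where
  Skip: "exec Skip s 1 s"
| NStore: "exec (NStore a i e) s (ntime i + ntime e + 1)
    (s\<lparr>nmem := (nmem s)(a := (nmem s a)(nval i s := nval e s))\<rparr>)"
| RStore: "exec (RStore a i e) s (ntime i + rtime e + 1)
    (s\<lparr>rmem := (rmem s)(a := (rmem s a)(nval i s := rval e s))\<rparr>)"
| Seq: "exec q s t s' \<Longrightarrow> exec q' s' t' s'' \<Longrightarrow> exec (Seq q q') s (t + t') s''"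
| CondTrue: "bval b s \<Longrightarrow> exec q s t s' \<Longrightarrow> exec (Cond b q q') s (btime b + 1 + t) s'"
| CondFalse: "\<not> bval b s \<Longrightarrow> exec q' s t s' \<Longrightarrow> exec (Cond b q q') s (btime b + 1 + t) s'"
| WhileFalse: "\<not> bval b s \<Longrightarrow> exec (While b q) s (btime b + 1) s"
| WhileTrue: "bval b s \<Longrightarrow> exec q s t s' \<Longrightarrow> exec (While b q) s' t' s'' \<Longrightarrow>
    exec (While b q) s (btime b + 1 + t + t') s''"

lemma exec_deterministic:
  "exec q s t s' \<Longrightarrow> exec q s u v \<Longrightarrow> u = t \<and> v = s'"
proof (induction arbitrary: u v rule: exec.induct)
  case (Skip s)
  then show ?case by cases simp
next
  case (NStore a i e s)
  then show ?case by cases simp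
next
  case (RStore a i e s)
  then show ?case by cases simp
next
  case (Seq q s t s' q' t' s'')
  from Seq.prems show ?case by cases (metis Seq.IH)
next
  case (CondTrue b s q t s' q')
  from CondTrue.prems show ?case by cases (metis CondTrue.IH CondTrue.hyps(1))+
next
  case (CondFalse b s q' t s' q)
  from CondFalse.prems show ?case by cases (metis CondFalse.IH CondFalse.hyps(1))+
next
  case (WhileFalse b s q)
  from WhileFalse.prems show ?case by cases (use WhileFalse.hyps in simp_all)
next
  case (WhileTrue b s q t s' t' s'')
  from WhileTrue.prems show ?case by cases (metis WhileTrue.IH WhileTrue.hyps(1))+
qed

text \<open>Memory not mentioned by \<open>holds_input\<close> has arbitrary initial contents.\<close>

definition holds_input :: "memory \<Rightarrow> fg_pattern \<Rightarrow> (nat \<Rightarrow> real) \<Rightarrow> bool" where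
  "holds_input s P c \<longleftrightarrow>
     nmem s ''n'' 0 = len P \<and> nmem s ''b'' 0 = nseg P \<and>
     (\<forall>k. 1 \<le> k \<and> k < nseg P \<longrightarrow> nmem s ''l'' k = lo P k \<and> nmem s ''r'' k = hi P k) \<and>
     (\<forall>k. 1 \<le> k \<and> k \<le> nseg P \<longrightarrow> rmem s ''eps'' k = thr P k) \<and>
     (\<forall>i. 1 \<le> i \<and> i \<le> len P \<longrightarrow> rmem s ''p'' i = val P i \<and> rmem s ''c'' i = c i)"

definition holds_output :: "memory \<Rightarrow> nat list \<Rightarrow> bool \<Rightarrow> bool" where
  "holds_output s bs rep \<longleftrightarrow>
     nmem s ''found'' 0 = length bs \<and>
     (\<forall>i<length bs. nmem s ''bp'' (i + 1) = bs ! i) \<and>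
     nmem s ''reported'' 0 = (if rep then 1 else 0)"

definition carries_out_procedure_within :: "(nat \<Rightarrow> nat) \<Rightarrow> prog \<Rightarrow> bool" where
  "carries_out_procedure_within T q \<longleftrightarrow>
     (\<forall>P c s. valid_pattern P \<and> holds_input s P c \<longrightarrow>
        (\<exists>t s' bs rep. exec q s t s' \<and> t \<le> T (len P) \<and>
           proc_run P c bs rep \<and> holds_output s' bs rep))"

end

theory Submission
  imports Defs
begin

text \<open>
  A segment condition \<open>ED_norm \<le> \<epsilon>\<close> says that the accumulated sum of \<open>\<delta>\<close> over the segment is
  nonpositive. Since break regions do not overlap, the segment after breakpoint \<open>k\<close> always contains
  \<open>hi P k + 1\<close>, so the admissible breakpoint with the least sum up to that position can replace
  any other choice of breakpoint \<open>k\<close> without losing a completion. For the running time, with prefix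
  sums of the squared differences every accumulated sum costs constant time, and the arg min scan
  of round \<open>k\<close> is paid for by the positions after \<open>hi P (k - 1)\<close> up to \<open>hi P k\<close>.
\<close>

section \<open>Correctness of the greedy choice\<close>

text \<open>Squaring is an equivalence because \<open>e\<close> is nonnegative, and clearing the
  factor \<open>1 / (b - a)\<close> because the segment is nonempty; the resulting
  \<open>(b - a) * e\<^sup>2\<close> is then spread over the terms.\<close>

lemma ED_norm_le_iff:
  assumes "a < b" "0 \<le> e"
  shows "ED_norm (slice x (a + 1) b) (slice y (a + 1) b) \<le> e \<longleftrightarrow>
    (\<Sum>i=a+1..b. \<bar>x i - y i\<bar>\<^sup>2 - e\<^sup>2) \<le> 0"
proof -
  let ?m = "real (b - a)" and ?s = "\<Sum>i=a+1..b. \<bar>x i - y i\<bar>\<^sup>2"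
  have m: "?m > 0" using assms by simp
  have "(\<Sum>i<b - a. \<bar>x (a + 1 + i) - y (a + 1 + i)\<bar>\<^sup>2) = ?s"
    by (rule sum.reindex_bij_witness[of _ "\<lambda>i. i - (a + 1)" "\<lambda>i. a + 1 + i"]) auto
  then have "ED_norm (slice x (a + 1) b) (slice y (a + 1) b) = sqrt (1 / ?m * ?s)"
    unfolding ED_norm_def slice_def
    by (auto intro!: arg_cong[of _ _ sqrt] arg_cong2[of _ _ _ _ "(*)"] sum.cong
        simp: nth_append nth_Cons' simp del: upt_Suc)
  also have "\<dots> \<le> e \<longleftrightarrow> 1 / ?m * ?s \<le> e\<^sup>2"
    using assms(2) real_sqrt_le_iff[of "1 / ?m * ?s" "e\<^sup>2"] by simp
  also have "\<dots> \<longleftrightarrow> ?s \<le> ?m * e\<^sup>2"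
    using m by (simp add: field_simps)
  also have "\<dots> \<longleftrightarrow> (\<Sum>i=a+1..b. \<bar>x i - y i\<bar>\<^sup>2 - e\<^sup>2) \<le> 0"
    using assms(1) by (simp add: sum_subtractf)
  finally show ?thesis .
qed

lemma ED_norm_le_iff_Delta:
  assumes "a < b" "0 \<le> e"
  shows "ED_norm (slice c (a + 1) b) (slice (val P) (a + 1) b) \<le> e \<longleftrightarrow> Delta P c (a + 1) b e \<le> 0"
    and "ED_norm (slice (val P) (a + 1) b) (slice c (a + 1) b) \<le> e \<longleftrightarrow> Delta P c (a + 1) b e \<le> 0"
  using ED_norm_le_iff[OF assms, of c "val P"] ED_norm_le_iff[OF assms, of "val P" c]
  by (simp_all add: Delta_def delta_def abs_minus_commute)

lemma Delta_split:
  assumes "a \<le> m" "m \<le> b"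
  shows "Delta P c (a + 1) b e = Delta P c (a + 1) m e + Delta P c (m + 1) b e"
  using sum.ub_add_nat[of "a + 1" m "\<lambda>i. delta P c i e" "b - m"] assms
  by (simp add: Delta_def)

text \<open>With \<open>region_start\<close>, this treats the fixed breakpoints \<open>0\<close> and
  \<open>len P\<close> as one-point regions, so that the first and last segments need no separate
  treatment.\<close>

definition region_end :: "fg_pattern \<Rightarrow> nat \<Rightarrow> nat" where
  "region_end P k = (if k = 0 then 0 else hi P k)"

definition region_start :: "fg_pattern \<Rightarrow> nat \<Rightarrow> nat" where
  "region_start P k = (if k < nseg P then lo P k else len P)"

lemma region_end_less_region_start:
  assumes "valid_pattern P" "1 \<le> k" "k \<le> nseg P"
  shows "region_end P (k - 1) < region_start P k"
proof (cases "k = 1")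
  case True
  then show ?thesis using assms by (force simp: valid_pattern_def region_end_def region_start_def)
next
  case False
  then have k: "1 \<le> k - 1" "k - 1 < nseg P" "k - 1 + 1 = k" using assms by auto
  \<comment> \<open>Subtraction is truncated; only with \<open>1 \<le> len P\<close> does the first
    bound give a strict one.\<close>
  have "hi P (k - 1) \<le> len P - 1" "1 \<le> len P"
    using assms k unfolding valid_pattern_def by blast+
  moreover have "k < nseg P \<Longrightarrow> hi P (k - 1) < lo P k"
    using assms k unfolding valid_pattern_def by metis
  ultimately show ?thesis
    using False k by (auto simp: region_end_def region_start_def)
qed

section \<open>Completions of a partial segmentation\<close>

text \<open>Entries of \<open>bp\<close> before \<open>k - 1\<close> are unconstrained, so past
  choices matter only through \<open>prev\<close>. Using \<open>Delta\<close> instead of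
  \<open>ED_norm\<close> avoids nonemptiness conditions when segments are exchanged.\<close>

definition completable :: "fg_pattern \<Rightarrow> (nat \<Rightarrow> real) \<Rightarrow> nat \<Rightarrow> nat \<Rightarrow> bool" where
  "completable P c k prev \<longleftrightarrow> (\<exists>bp. bp (k - 1) = prev \<and> bp (nseg P) = len P \<and>
     (\<forall>i. k \<le> i \<and> i < nseg P \<longrightarrow> bp i \<in> {lo P i..hi P i}) \<and>
     (\<forall>i\<in>{k..nseg P}. Delta P c (bp (i - 1) + 1) (bp i) (thr P i) \<le> 0))"

lemma fine_grained_match_iff_completable:
  assumes "valid_pattern P"
  shows "fine_grained_match P c \<longleftrightarrow> completable P c 1 0"
proof -
  have "ED_norm (slice (val P) (bp (k - 1) + 1) (bp k)) (slice c (bp (k - 1) + 1) (bp k)) \<le> thr P k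
      \<longleftrightarrow> Delta P c (bp (k - 1) + 1) (bp k) (thr P k) \<le> 0"
    if bp: "segmentation P bp" and k: "k \<in> {1..nseg P}" for bp k
  proof (rule ED_norm_le_iff_Delta(2))
    have "bp (k - 1) \<le> region_end P (k - 1)"
      using bp k by (cases "k = 1")
        (auto simp: segmentation_def region_end_def dest!: spec[of _ "k - 1"])
    also have "\<dots> < region_start P k"
      using region_end_less_region_start[OF assms] k by simp
    also have "\<dots> \<le> bp k"
      using bp k by (cases "k = nseg P") (auto simp: segmentation_def region_start_def)
    finally show "bp (k - 1) < bp k" .
    show "0 \<le> thr P k" using assms k by (simp add: valid_pattern_def)
  qed
  then show ?thesis
    unfolding fine_grained_match_def completable_def segmentation_def by auto
qed

lemma completable_finish:
  assumes "1 \<le> nseg P"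
  shows "completable P c (nseg P) prev \<longleftrightarrow> Delta P c (prev + 1) (len P) (thr P (nseg P)) \<le> 0"
proof
  assume "Delta P c (prev + 1) (len P) (thr P (nseg P)) \<le> 0"
  then show "completable P c (nseg P) prev"
    unfolding completable_def using assms
    \<comment> \<open>Only the entries \<open>nseg P - 1\<close> and \<open>nseg P\<close> are read;
      they are distinct because \<open>1 \<le> nseg P\<close>.\<close>
    by (intro exI[of _ "\<lambda>i. if i = nseg P then len P else prev"]) auto
qed (auto simp: completable_def)

lemma completable_imp_PS:
  assumes "completable P c k prev" "k < nseg P"
  shows "\<exists>j\<in>PS P c k prev. completable P c (k + 1) j"
proof -
  from assms(1) obtain bp where bp: "bp (k - 1) = prev" "bp (nseg P) = len P"
    "\<forall>i. k \<le> i \<and> i < nseg P \<longrightarrow> bp i \<in> {lo P i..hi P i}"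
    "\<forall>i\<in>{k..nseg P}. Delta P c (bp (i - 1) + 1) (bp i) (thr P i) \<le> 0"
    unfolding completable_def by blast
  have "bp k \<in> PS P c k prev" using bp assms(2) by (auto simp: PS_def)
  moreover have "completable P c (k + 1) (bp k)"
    unfolding completable_def using bp by (intro exI[of _ bp]) auto
  ultimately show ?thesis by blast
qed

lemma completable_if_PS:
  assumes "j \<in> PS P c k prev" "completable P c (k + 1) j" "k < nseg P" "1 \<le> k"
  shows "completable P c k prev"
proof -
  from assms(2) obtain bp where bp: "bp k = j" "bp (nseg P) = len P"
    "\<forall>i. k + 1 \<le> i \<and> i < nseg P \<longrightarrow> bp i \<in> {lo P i..hi P i}"
    "\<forall>i\<in>{k + 1..nseg P}. Delta P c (bp (i - 1) + 1) (bp i) (thr P i) \<le> 0"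
    unfolding completable_def by auto
  \<comment> \<open>Since \<open>1 \<le> k\<close>, overwriting entry \<open>k - 1\<close> leaves
    \<open>bp k\<close> and all later entries intact.\<close>
  have "Delta P c ((bp(k - 1 := prev)) (i - 1) + 1) ((bp(k - 1 := prev)) i) (thr P i) \<le> 0"
    if "i \<in> {k..nseg P}" for i
  proof (cases "i = k")
    case True
    then show ?thesis using assms bp(1) by (auto simp: PS_def)
  next
    case False
    then show ?thesis using bp(4) that assms(4) by auto
  qed
  moreover have "(bp(k - 1 := prev)) i \<in> {lo P i..hi P i}" if "k \<le> i" "i < nseg P" for i
    using bp(1,3) assms(1,4) that by (cases "i = k") (auto simp: PS_def)
  ultimately show ?thesis
    unfolding completable_def using bp(2) assms(3,4)
    by (intro exI[of _ "bp(k - 1 := prev)"]) auto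
qed

text \<open>
  Every later breakpoint lies beyond \<open>hi P k\<close>, so replacing \<open>i\<close> by \<open>j\<close> changes the next
  accumulated sum by an amount that does not depend on where the next segment ends.
\<close>

lemma completable_exchange:
  assumes "valid_pattern P" "1 \<le> k" "k < nseg P" "completable P c (k + 1) i"
    and "i \<le> hi P k" "j \<le> hi P k"
    and le: "Delta P c (j + 1) (hi P k + 1) (thr P (k + 1))
      \<le> Delta P c (i + 1) (hi P k + 1) (thr P (k + 1))"
  shows "completable P c (k + 1) j"
proof -
  from assms(4) obtain bp where bp: "bp k = i" "bp (nseg P) = len P"
    "\<forall>i. k + 1 \<le> i \<and> i < nseg P \<longrightarrow> bp i \<in> {lo P i..hi P i}"
    "\<forall>i\<in>{k + 1..nseg P}. Delta P c (bp (i - 1) + 1) (bp i) (thr P i) \<le> 0"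
    unfolding completable_def by auto
  let ?e = "thr P (k + 1)"
  have "region_end P k < region_start P (k + 1)"
    using region_end_less_region_start[of P "k + 1"] assms by simp
  then have far: "hi P k + 1 \<le> bp (k + 1)"
    using bp(2,3) assms(2,3)
    by (cases "k + 1 = nseg P") (auto simp: region_end_def region_start_def dest!: spec[of _ "k + 1"])
  have "Delta P c (j + 1) (bp (k + 1)) ?e
      = Delta P c (j + 1) (hi P k + 1) ?e + Delta P c (hi P k + 1 + 1) (bp (k + 1)) ?e"
    using assms(6) far by (intro Delta_split) auto
  also have "\<dots> \<le> Delta P c (i + 1) (hi P k + 1) ?e + Delta P c (hi P k + 1 + 1) (bp (k + 1)) ?e"
    using le by simp
  also have "\<dots> = Delta P c (i + 1) (bp (k + 1)) ?e"
    using assms(5) far by (intro Delta_split[symmetric]) auto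
  also have "\<dots> \<le> 0" using bp(1,4) assms(3) by (auto dest!: bspec[of _ _ "k + 1"])
  finally have first: "Delta P c (j + 1) (bp (k + 1)) ?e \<le> 0" .
  \<comment> \<open>Among the remaining segments only segment \<open>k + 1\<close> has breakpoint
    \<open>k\<close> as an end.\<close>
  have "Delta P c ((bp(k := j)) (m - 1) + 1) ((bp(k := j)) m) (thr P m) \<le> 0"
    if "m \<in> {k + 1..nseg P}" for m
    using first bp(4) that by (cases "m = k + 1") auto
  then show ?thesis
    unfolding completable_def using bp(2,3) assms(3) by (intro exI[of _ "bp(k := j)"]) auto
qed

section \<open>Runs of the procedure decide completability\<close>

text \<open>Completability is preserved in both directions by each greedy choice: any admissible
  first breakpoint of a completion can be exchanged for the minimiser. The bound on
  \<open>prev\<close> makes the last segment nonempty.\<close>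

lemma proc_from_iff_completable:
  assumes "proc_from P c k prev bs rep" "valid_pattern P" "1 \<le> k" "prev \<le> region_end P (k - 1)"
  shows "rep \<longleftrightarrow> completable P c k prev"
  using assms
proof (induction rule: proc_from.induct)
  case (stop k prev)
  then show ?case using completable_imp_PS by blast
next
  case (choose k prev j bs rep)
  have j: "j \<in> PS P c k prev"
    and min: "\<And>i. i \<in> PS P c k prev \<Longrightarrow> Delta P c (j + 1) (hi P k + 1) (thr P (k + 1))
      \<le> Delta P c (i + 1) (hi P k + 1) (thr P (k + 1))"
    using choose.hyps(2) by (auto simp: is_arg_min_linorder)
  have hi: "i \<le> hi P k" if "i \<in> PS P c k prev" for i using that by (simp add: PS_def)
  have "completable P c k prev \<longleftrightarrow> completable P c (k + 1) j"
  proof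
    assume "completable P c k prev"
    then obtain i where i: "i \<in> PS P c k prev" "completable P c (k + 1) i"
      using completable_imp_PS choose.hyps(1) by blast
    show "completable P c (k + 1) j"
      using choose i j by (intro completable_exchange[OF _ _ _ i(2)] hi min) auto
  qed (use completable_if_PS j choose in blast)
  moreover have "rep \<longleftrightarrow> completable P c (k + 1) j"
    using choose hi[OF j] by (intro choose.IH) (auto simp: region_end_def)
  ultimately show ?case by simp
next
  case (finish k prev)
  have "prev < len P"
    using finish region_end_less_region_start[of P k] by (auto simp: region_start_def)
  moreover have "0 \<le> thr P k" using finish by (auto simp: valid_pattern_def)
  ultimately show ?case
    using finish completable_finish ED_norm_le_iff_Delta(1) by auto
qed

text \<open>Downward induction on the round, for all \<open>prev\<close> at once; a finite nonempty
  candidate set has a minimiser.\<close>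

lemma proc_from_total:
  assumes "k \<le> nseg P"
  shows "\<exists>bs rep. proc_from P c k prev bs rep"
  using assms
proof (induction arbitrary: prev rule: inc_induct)
  case base
  then show ?case by (blast intro: proc_from.finish)
next
  case (step k)
  show ?case
  proof (cases "PS P c k prev = {}")
    case True
    then show ?thesis using step by (blast intro: proc_from.stop)
  next
    case False
    have "finite (PS P c k prev)" by (simp add: PS_def)
    then obtain j where
      "is_arg_min (\<lambda>j. Delta P c (j + 1) (hi P k + 1) (thr P (k + 1))) (\<lambda>j. j \<in> PS P c k prev) j"
      using False ex_is_arg_min_if_finite by blast
    then show ?thesis using step.IH[of j] step.hyps by (fastforce intro: proc_from.choose)
  qed
qed


section \<open>Weakest preconditions with time\<close>

text \<open>One halting execution suffices for total correctness, as execution is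
  deterministic.\<close>

definition wp :: "prog \<Rightarrow> memory \<Rightarrow> (nat \<Rightarrow> memory \<Rightarrow> bool) \<Rightarrow> bool" where
  "wp q s Q \<longleftrightarrow> (\<exists>t s'. exec q s t s' \<and> Q t s')"

lemma wp_mono: "wp q s Q \<Longrightarrow> (\<And>t s'. Q t s' \<Longrightarrow> R t s') \<Longrightarrow> wp q s R"
  unfolding wp_def by blast

lemma wp_Skip: "Q 1 s \<Longrightarrow> wp Skip s Q"
  unfolding wp_def by (blast intro: exec.Skip)

lemma wp_NStore:
  "Q (ntime i + ntime e + 1) (s\<lparr>nmem := (nmem s)(a := (nmem s a)(nval i s := nval e s))\<rparr>) \<Longrightarrow>
    wp (NStore a i e) s Q"
  unfolding wp_def by (blast intro: exec.NStore)

lemma wp_RStore: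
  "Q (ntime i + rtime e + 1) (s\<lparr>rmem := (rmem s)(a := (rmem s a)(nval i s := rval e s))\<rparr>) \<Longrightarrow>
    wp (RStore a i e) s Q"
  unfolding wp_def by (blast intro: exec.RStore)

lemma wp_Seq: "wp q s (\<lambda>t s'. wp q' s' (\<lambda>t'. Q (t + t'))) \<Longrightarrow> wp (Seq q q') s Q"
  unfolding wp_def by (blast intro: exec.Seq)

lemma wp_Cond:
  assumes "bval b s \<Longrightarrow> wp q s (\<lambda>t. Q (btime b + 1 + t))"
    and "\<not> bval b s \<Longrightarrow> wp q' s (\<lambda>t. Q (btime b + 1 + t))"
  shows "wp (Cond b q q') s Q"
  using assms unfolding wp_def
  by (cases "bval b s") (blast intro: exec.CondTrue exec.CondFalse)+

text \<open>The potential \<open>\<Phi>\<close> pays for the iterations and serves as the termination measure.\<close>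

lemma wp_While:
  assumes "I s"
    and step: "\<And>s. I s \<Longrightarrow> bval b s \<Longrightarrow> wp q s (\<lambda>t s'. I s' \<and> btime b + 1 + t + \<Phi> s' \<le> \<Phi> s)"
    and exit: "\<And>t s'. I s' \<Longrightarrow> \<not> bval b s' \<Longrightarrow> t \<le> \<Phi> s + btime b + 1 \<Longrightarrow> Q t s'"
  shows "wp (While b q) s Q"
proof -
  have "\<exists>t s'. exec (While b q) s t s' \<and> I s' \<and> \<not> bval b s' \<and> t \<le> \<Phi> s + btime b + 1"
    using assms(1)
  proof (induction "\<Phi> s" arbitrary: s rule: less_induct)
    case less
    show ?case
    proof (cases "bval b s")
      case True
      then obtain t s' where s': "exec q s t s'" "I s'" "btime b + 1 + t + \<Phi> s' \<le> \<Phi> s"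
        using step[OF less.prems] unfolding wp_def by blast
      \<comment> \<open>Each iteration costs at least one unit, so \<open>\<Phi>\<close> strictly
        decreases. The final failing test is charged outside \<open>\<Phi>\<close>.\<close>
      then obtain t' s'' where s'': "exec (While b q) s' t' s''" "I s''" "\<not> bval b s''"
        "t' \<le> \<Phi> s' + btime b + 1"
        using less.hyps[of s'] by auto
      have "exec (While b q) s (btime b + 1 + t + t') s''"
        using exec.WhileTrue[OF True s'(1) s''(1)] .
      moreover have "btime b + 1 + t + t' \<le> \<Phi> s + btime b + 1" using s'(3) s''(4) by linarith
      ultimately show ?thesis using s'' by blast
    next
      case False
      then show ?thesis using exec.WhileFalse[OF False] less.prems by fastforce
    qed
  qed
  then show ?thesis using exit unfolding wp_def by blast
qed

lemmas wp_intros = wp_Skip wp_NStore wp_RStore wp_Seq wp_Cond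


section \<open>A linear-time implementation\<close>

abbreviation NVar :: "string \<Rightarrow> nexp" where "NVar x \<equiv> NCell x (NNum 0)"
abbreviation NSet :: "string \<Rightarrow> nexp \<Rightarrow> prog" where "NSet x \<equiv> NStore x (NNum 0)"
abbreviation NSuc :: "nexp \<Rightarrow> nexp" where "NSuc e \<equiv> NPlus e (NNum 1)"
abbreviation NPred :: "nexp \<Rightarrow> nexp" where "NPred e \<equiv> NMinus e (NNum 1)"

text \<open>
  \<open>S i\<close> holds the sum of the first \<open>i\<close> squared differences; \<open>N i\<close> holds \<open>i\<close> as a real, since
  the machine has no conversion from naturals to reals.
\<close>

definition prefix_sums_prog :: prog where
  "prefix_sums_prog =
    Seq (RStore ''S'' (NNum 0) (RNum 0))
    (Seq (RStore ''N'' (NNum 0) (RNum 0))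
    (Seq (NSet ''i'' (NNum 0))
    (While (NLe (NSuc (NVar ''i'')) (NVar ''n''))
      (Seq (NSet ''i'' (NSuc (NVar ''i'')))
      (Seq (RStore ''S'' (NVar ''i'')
         (RPlus (RCell ''S'' (NPred (NVar ''i'')))
           (RTimes (RMinus (RCell ''c'' (NVar ''i'')) (RCell ''p'' (NVar ''i'')))
                   (RMinus (RCell ''c'' (NVar ''i'')) (RCell ''p'' (NVar ''i''))))))
      (RStore ''N'' (NVar ''i'') (RPlus (RCell ''N'' (NPred (NVar ''i''))) (RNum 1))))))))"

text \<open>The accumulated sum over \<open>a + 1, ..., b\<close> as a difference of prefix sums
  minus length times squared threshold.\<close>

definition Delta_exp :: "nexp \<Rightarrow> nexp \<Rightarrow> nexp \<Rightarrow> rexp" where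
  "Delta_exp a b k =
    RMinus (RMinus (RCell ''S'' b) (RCell ''S'' a))
      (RTimes (RMinus (RCell ''N'' b) (RCell ''N'' a)) (RTimes (RCell ''eps'' k) (RCell ''eps'' k)))"

abbreviation prev_exp :: nexp where "prev_exp \<equiv> NCell ''bp'' (NPred (NVar ''k''))"
abbreviation hi_exp :: nexp where "hi_exp \<equiv> NCell ''r'' (NVar ''k'')"
abbreviation score_exp :: "string \<Rightarrow> rexp" where
  "score_exp x \<equiv> Delta_exp (NVar x) (NSuc hi_exp) (NSuc (NVar ''k''))"

text \<open>\<open>m\<close> is the best candidate so far; the value \<open>hi P k + 1\<close> means that there is none yet.\<close>

definition scan_prog :: prog where
  "scan_prog =
    Seq (NSet ''j'' (NCell ''l'' (NVar ''k'')))
    (Seq (NSet ''m'' (NSuc hi_exp))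
    (While (NLe (NVar ''j'') hi_exp)
      (Seq
        (Cond (Conj (RLe (Delta_exp prev_exp (NVar ''j'') (NVar ''k'')) (RNum 0))
                    (Neg (Conj (NLe (NVar ''m'') hi_exp) (RLe (score_exp ''m'') (score_exp ''j'')))))
          (NSet ''m'' (NVar ''j''))
          Skip)
        (NSet ''j'' (NSuc (NVar ''j''))))))"

text \<open>Cell \<open>0\<close> of \<open>bp\<close> serves as the predecessor in round
  \<open>1\<close>. After a failed scan \<open>k\<close> stays at the failing round, so
  \<open>k - 1\<close> always counts the breakpoints found.\<close>

definition rounds_prog :: prog where
  "rounds_prog =
    Seq (NSet ''bp'' (NNum 0))
    (Seq (NSet ''k'' (NNum 1))
    (Seq (NSet ''ok'' (NNum 1))
    (While (Conj (NLe (NNum 1) (NVar ''ok'')) (NLe (NSuc (NVar ''k'')) (NVar ''b'')))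
      (Seq scan_prog
        (Cond (NLe (NVar ''m'') hi_exp)
          (Seq (NStore ''bp'' (NVar ''k'') (NVar ''m'')) (NSet ''k'' (NSuc (NVar ''k''))))
          (NSet ''ok'' (NNum 0)))))))"

text \<open>The machine has no square root; the sign of the accumulated sum replaces the comparison
  of \<open>ED_norm\<close>.\<close>

definition report_prog :: prog where
  "report_prog =
    Seq (NSet ''found'' (NPred (NVar ''k'')))
    (Cond (Conj (NLe (NNum 1) (NVar ''ok''))
                (RLe (Delta_exp prev_exp (NVar ''n'') (NVar ''b'')) (RNum 0)))
      (NSet ''reported'' (NNum 1))
      (NSet ''reported'' (NNum 0)))"

section \<open>Memory contents and prefix sums\<close>

definition holds_prefix_sums :: "memory \<Rightarrow> fg_pattern \<Rightarrow> (nat \<Rightarrow> real) \<Rightarrow> nat \<Rightarrow> bool" where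
  "holds_prefix_sums s P c m \<longleftrightarrow> (\<forall>i\<le>m. rmem s ''N'' i = real i \<and>
     rmem s ''S'' i = (\<Sum>j=1..i. (c j - val P j)\<^sup>2))"

lemma memory_update_same [simp]:
  "nmem s = f \<Longrightarrow> s\<lparr>nmem := f\<rparr> = s"
  "rmem s = g \<Longrightarrow> s\<lparr>rmem := g\<rparr> = s"
  by auto

text \<open>Stores to non-input arrays are peeled off one by one; \<open>memory_update_same\<close>
  removes the trivial update left at the end.\<close>

lemma holds_input_update [simp]:
  "\<lbrakk>''n'' \<noteq> a; ''b'' \<noteq> a; ''l'' \<noteq> a; ''r'' \<noteq> a\<rbrakk> \<Longrightarrow>
    holds_input (s\<lparr>nmem := f(a := x)\<rparr>) P c \<longleftrightarrow> holds_input (s\<lparr>nmem := f\<rparr>) P c"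
  "\<lbrakk>''eps'' \<noteq> a; ''p'' \<noteq> a; ''c'' \<noteq> a\<rbrakk> \<Longrightarrow>
    holds_input (s\<lparr>rmem := g(a := y)\<rparr>) P c \<longleftrightarrow> holds_input (s\<lparr>rmem := g\<rparr>) P c"
  by (simp_all add: holds_input_def)

lemma holds_prefix_sums_nmem_update [simp]:
  "holds_prefix_sums (s\<lparr>nmem := g\<rparr>) P c m \<longleftrightarrow> holds_prefix_sums s P c m"
  by (simp add: holds_prefix_sums_def)

lemma rtime_Delta_exp [simp]:
  "rtime (Delta_exp a b k) = 2 * ntime a + 2 * ntime b + 2 * ntime k + 11"
  by (simp add: Delta_exp_def)

lemma rval_Delta_exp:
  assumes "holds_input s P c" "holds_prefix_sums s P c (len P)"
    and "nval a s \<le> nval b s" "nval b s \<le> len P" "1 \<le> nval k s" "nval k s \<le> nseg P"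
  shows "rval (Delta_exp a b k) s = Delta P c (nval a s + 1) (nval b s) (thr P (nval k s))"
proof -
  let ?d = "\<lambda>j. (c j - val P j)\<^sup>2"
  have "(\<Sum>j=1..nval b s. ?d j) = (\<Sum>j=1..nval a s. ?d j) + (\<Sum>j=nval a s + 1..nval b s. ?d j)"
    using assms(3) sum.ub_add_nat[of 1 "nval a s" ?d "nval b s - nval a s"] by simp
  then show ?thesis
    using assms
    by (simp add: Delta_exp_def holds_prefix_sums_def holds_input_def Delta_def delta_def
        sum_subtractf of_nat_diff power2_eq_square)
qed

lemma wp_prefix_sums_prog:
  assumes "holds_input s P c"
  shows "wp prefix_sums_prog s (\<lambda>t s'. holds_input s' P c \<and> holds_prefix_sums s' P c (len P) \<and>
    t \<le> 60 * len P + 20)"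
  unfolding prefix_sums_prog_def
  apply (intro wp_intros)
  \<comment> \<open>The factor \<open>60\<close> generously bounds the cost of one iteration
    including its test.\<close>
  apply (rule wp_While[where \<Phi> = "\<lambda>s. 60 * (len P - nmem s ''i'' 0)" and
        I = "\<lambda>s. holds_input s P c \<and> nmem s ''i'' 0 \<le> len P \<and> holds_prefix_sums s P c (nmem s ''i'' 0)"])
  subgoal using assms by (simp add: holds_prefix_sums_def)
  subgoal for s
    apply (intro wp_intros)
    apply (auto simp: holds_prefix_sums_def le_Suc_eq power2_eq_square)
    apply (auto simp: holds_input_def)
    done
  subgoal premises exit for t s'
  proof -
    have "nmem s' ''n'' 0 = len P" using exit(1) by (simp add: holds_input_def)
    then have "nmem s' ''i'' 0 = len P" using exit(1,2) by (simp add: not_less_eq_eq)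
    then show ?thesis using exit(1,3) by simp
  qed
  done

section \<open>The arg min scan of one round\<close>

definition scan_invariant ::
    "fg_pattern \<Rightarrow> (nat \<Rightarrow> real) \<Rightarrow> nat \<Rightarrow> (nat \<Rightarrow> nat) \<Rightarrow> memory \<Rightarrow> bool" where
  "scan_invariant P c k bp s \<longleftrightarrow>
     holds_input s P c \<and> holds_prefix_sums s P c (len P) \<and>
     nmem s ''bp'' = bp \<and> nmem s ''k'' 0 = k \<and> nmem s ''ok'' 0 = 1"

text \<open>At \<open>j = hi P k + 1\<close> this says that \<open>m\<close> is an arg min over
  \<open>PS\<close>, or that \<open>PS\<close> is empty.\<close>

definition best_upto :: "fg_pattern \<Rightarrow> (nat \<Rightarrow> real) \<Rightarrow> nat \<Rightarrow> nat \<Rightarrow> nat \<Rightarrow> nat \<Rightarrow> bool" where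
  "best_upto P c k prev j m \<longleftrightarrow>
     (if m \<le> hi P k
      then m \<in> PS P c k prev \<and> (\<forall>i\<in>PS P c k prev. i < j \<longrightarrow>
        Delta P c (m + 1) (hi P k + 1) (thr P (k + 1))
          \<le> Delta P c (i + 1) (hi P k + 1) (thr P (k + 1)))
      else m = hi P k + 1 \<and> (\<forall>i\<in>PS P c k prev. j \<le> i))"

text \<open>An existing candidate is replaced only on strict improvement, so by transitivity the new
  one is still no worse than all earlier ones.\<close>

lemma best_upto_step:
  assumes "best_upto P c k prev j m" "lo P k \<le> j" "j \<le> hi P k"
  shows "best_upto P c k prev (j + 1)
    (if Delta P c (prev + 1) j (thr P k) \<le> 0 \<and>
        \<not> (m \<le> hi P k \<and> Delta P c (m + 1) (hi P k + 1) (thr P (k + 1))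
             \<le> Delta P c (j + 1) (hi P k + 1) (thr P (k + 1)))
     then j else m)"
proof -
  have j: "j \<in> PS P c k prev \<longleftrightarrow> Delta P c (prev + 1) j (thr P k) \<le> 0"
    using assms by (simp add: PS_def)
  have lt: "i < j + 1 \<longleftrightarrow> i < j \<or> i = j" and ge: "j + 1 \<le> i \<longleftrightarrow> j \<le> i \<and> i \<noteq> j" for i
    by auto
  show ?thesis
  proof (cases "m \<le> hi P k")
    case True
    then show ?thesis using assms j by (fastforce simp: best_upto_def lt simp del: One_nat_def)
  next
    case False
    then show ?thesis using assms j by (fastforce simp: best_upto_def lt ge simp del: One_nat_def)
  qed
qed

lemma wp_scan_prog:
  assumes "valid_pattern P" "1 \<le> k" "k < nseg P" "bp (k - 1) \<le> region_end P (k - 1)"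
    and "scan_invariant P c k bp s"
  shows "wp scan_prog s (\<lambda>t s'. scan_invariant P c k bp s' \<and>
    best_upto P c k (bp (k - 1)) (hi P k + 1) (nmem s' ''m'' 0) \<and>
    t \<le> 200 * (hi P k + 1 - lo P k) + 50)"
proof -
  let ?prev = "bp (k - 1)"
  let ?D = "\<lambda>j. Delta P c (?prev + 1) j (thr P k)"
  let ?F = "\<lambda>j. Delta P c (j + 1) (hi P k + 1) (thr P (k + 1))"
  \<comment> \<open>These keep every difference of prefix sums in range, including the score's right
    end \<open>hi P k + 1\<close>.\<close>
  have bounds: "?prev < lo P k" "lo P k \<le> hi P k" "hi P k + 1 \<le> len P"
    using assms region_end_less_region_start[of P k]
    by (auto simp: region_start_def valid_pattern_def dest!: spec[of _ k])
  define I where "I s \<longleftrightarrow> scan_invariant P c k bp s \<and>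
      lo P k \<le> nmem s ''j'' 0 \<and> nmem s ''j'' 0 \<le> hi P k + 1 \<and>
      best_upto P c k ?prev (nmem s ''j'' 0) (nmem s ''m'' 0)" for s
  have reads: "nmem s ''l'' k = lo P k" "nmem s ''r'' k = hi P k" "nmem s ''k'' 0 = k"
    if "scan_invariant P c k bp s" for s
    using that assms(2,3) by (simp_all add: scan_invariant_def holds_input_def)
  show ?thesis
    unfolding scan_prog_def
  proof (intro wp_intros, rule wp_While[where I = I and
        \<Phi> = "\<lambda>s. 200 * (hi P k + 1 - nmem s ''j'' 0)"], goal_cases)
    case 1
    have "\<forall>i\<in>PS P c k ?prev. lo P k \<le> i" by (simp add: PS_def)
    then show ?case
      using assms(5) bounds reads[OF assms(5)]
      by (simp add: I_def scan_invariant_def best_upto_def)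
  next
    case (2 s)
    let ?j = "nmem s ''j'' 0" and ?m = "nmem s ''m'' 0"
    have inv: "scan_invariant P c k bp s" and j: "lo P k \<le> ?j" "?j \<le> hi P k"
      and best: "best_upto P c k ?prev ?j ?m"
      using 2 reads[of s] by (auto simp: I_def)
    have m: "?m \<le> hi P k + 1" using best by (auto simp: best_upto_def split: if_splits)
    have D: "rval (Delta_exp prev_exp (NVar ''j'') (NVar ''k'')) s = ?D ?j"
      using inv j bounds assms(2,3) by (subst rval_Delta_exp) (auto simp: scan_invariant_def)
    \<comment> \<open>The placeholder \<open>hi P k + 1\<close> is covered too: its score is an
      empty sum.\<close>
    have F: "rval (score_exp x) s = ?F (nmem s x 0)" if "nmem s x 0 \<le> hi P k + 1" for x
      using inv that reads[OF inv] bounds assms(2,3)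
      by (subst rval_Delta_exp) (auto simp: scan_invariant_def)
    show ?case
      using best_upto_step[OF best j] inv j
      by (intro wp_intros)
        (auto simp: D F m reads[OF inv] I_def scan_invariant_def simp del: One_nat_def split: if_splits)
  next
    case (3 t s)
    then have "nmem s ''j'' 0 = hi P k + 1" using reads[of s] by (auto simp: I_def)
    then show ?case using 3 assms(5) reads[OF assms(5)] by (auto simp: I_def scan_invariant_def)
  qed
qed

section \<open>All rounds and their amortised cost\<close>

text \<open>\<open>proc_from\<close> builds runs from the back while the program proceeds forwards,
  so the history is recorded by how it extends any continuation to a full run.\<close>

definition rounds_invariant :: "fg_pattern \<Rightarrow> (nat \<Rightarrow> real) \<Rightarrow> memory \<Rightarrow> bool" where
  "rounds_invariant P c s \<longleftrightarrow>
     holds_input s P c \<and> holds_prefix_sums s P c (len P) \<and>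
     (let k = nmem s ''k'' 0; bp = nmem s ''bp'' in
       1 \<le> k \<and> k \<le> nseg P \<and> bp (k - 1) \<le> region_end P (k - 1) \<and>
       (\<forall>bs rep. proc_from P c k (bp (k - 1)) bs rep \<longrightarrow> proc_run P c (map bp [1..<k] @ bs) rep) \<and>
       (nmem s ''ok'' 0 = 0 \<and> k < nseg P \<and> PS P c k (bp (k - 1)) = {} \<or> nmem s ''ok'' 0 = 1))"

lemma wp_rounds_prog:
  assumes "valid_pattern P" "holds_input s P c" "holds_prefix_sums s P c (len P)"
  shows "wp rounds_prog s (\<lambda>t s'. rounds_invariant P c s' \<and>
    (nmem s' ''ok'' 0 = 1 \<longrightarrow> nmem s' ''k'' 0 = nseg P) \<and> t \<le> 400 * len P + 50)"
proof -
  \<comment> \<open>A successful round \<open>k\<close> lowers this by \<open>400\<close> per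
    position from \<open>region_end P (k - 1)\<close> to \<open>hi P k\<close>. There is at least
    one such position and at least as many as the region has, so scan and fixed overhead are both
    paid. Failure releases the whole potential.\<close>
  define \<Phi> where "\<Phi> s = (if nmem s ''ok'' 0 = 1
    then 400 * (len P - region_end P (nmem s ''k'' 0 - 1)) else 0)" for s :: memory
  show ?thesis
    unfolding rounds_prog_def
  proof (intro wp_Seq wp_NStore, rule wp_While[where I = "rounds_invariant P c" and \<Phi> = \<Phi>],
      goal_cases)
    case 1
    then show ?case using assms by (simp add: rounds_invariant_def proc_run_def valid_pattern_def)
  next
    case (2 s)
    let ?k = "nmem s ''k'' 0" and ?bp = "nmem s ''bp''"
    let ?prev = "?bp (?k - 1)"
    have k: "1 \<le> ?k" "?k < nseg P" and prev: "?prev \<le> region_end P (?k - 1)"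
      and inv: "scan_invariant P c ?k ?bp s"
      and run: "\<And>bs rep. proc_from P c ?k ?prev bs rep \<Longrightarrow> proc_run P c (map ?bp [1..<?k] @ bs) rep"
      using 2 by (auto simp: rounds_invariant_def Let_def holds_input_def scan_invariant_def)
    have bounds: "region_end P (?k - 1) < lo P ?k" "lo P ?k \<le> hi P ?k" "hi P ?k + 1 \<le> len P"
      using assms(1) k region_end_less_region_start[of P ?k]
      by (auto simp: region_start_def valid_pattern_def dest!: spec[of _ ?k])
    have ok: "nmem s ''ok'' 0 = 1"
      using inv by (simp add: scan_invariant_def)
    show ?case
    proof (intro wp_Seq, rule wp_mono[OF wp_scan_prog[OF assms(1) k prev inv]])
      fix t and s' :: memory
      let ?m = "nmem s' ''m'' 0"
      assume "scan_invariant P c ?k ?bp s' \<and> best_upto P c ?k ?prev (hi P ?k + 1) ?m \<and>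
        t \<le> 200 * (hi P ?k + 1 - lo P ?k) + 50"
      then have inv': "scan_invariant P c ?k ?bp s'"
        and best: "best_upto P c ?k ?prev (hi P ?k + 1) ?m"
        and t: "t \<le> 200 * (hi P ?k + 1 - lo P ?k) + 50" by auto
      have s': "nmem s' ''r'' ?k = hi P ?k" "nmem s' ''k'' 0 = ?k" "nmem s' ''bp'' = ?bp"
        "nmem s' ''ok'' 0 = 1" "holds_input s' P c" "holds_prefix_sums s' P c (len P)"
        using inv' k by (auto simp: scan_invariant_def holds_input_def)
      have PS_le: "i < hi P ?k + 1" if "i \<in> PS P c ?k ?prev" for i using that by (simp add: PS_def)
      \<comment> \<open>The chosen breakpoint is put in front of the continuation by
        \<open>proc_from.choose\<close>.\<close>
      have found: "proc_run P c (map (?bp(?k := ?m)) [1..<?k + 1] @ bs) rep"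
        if "?m \<le> hi P ?k" "proc_from P c (?k + 1) ?m bs rep" for bs rep
      proof -
        have "is_arg_min (\<lambda>j. Delta P c (j + 1) (hi P ?k + 1) (thr P (?k + 1)))
            (\<lambda>j. j \<in> PS P c ?k ?prev) ?m"
          using best that(1) PS_le by (auto simp: best_upto_def is_arg_min_linorder)
        then have "proc_run P c (map ?bp [1..<?k] @ ?m # bs) rep"
          using run proc_from.choose k(2) that(2) by blast
        then show ?thesis using k(1) by simp
      qed
      have none: "PS P c ?k ?prev = {}" if "\<not> ?m \<le> hi P ?k"
        using best that PS_le by (fastforce simp: best_upto_def)
      show "wp (Cond (NLe (NVar ''m'') hi_exp)
          (Seq (NStore ''bp'' (NVar ''k'') (NVar ''m'')) (NSet ''k'' (NSuc (NVar ''k''))))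
          (NSet ''ok'' (NNum 0))) s'
        (\<lambda>t' s'. rounds_invariant P c s' \<and>
          btime (Conj (NLe (NNum 1) (NVar ''ok'')) (NLe (NSuc (NVar ''k'')) (NVar ''b''))) + 1 +
            (t + t') + \<Phi> s' \<le> \<Phi> s)"
        using k prev run found none t bounds s' ok
        by (intro wp_intros)
          (auto simp: rounds_invariant_def \<Phi>_def region_end_def Let_def)
    qed
  next
    case (3 t s')
    then show ?case by (auto simp: rounds_invariant_def Let_def holds_input_def \<Phi>_def)
  qed
qed

section \<open>The final test and the total time\<close>

text \<open>The recorded history is closed with \<open>proc_from.finish\<close> if all breakpoints
  were found, and with \<open>proc_from.stop\<close> otherwise.\<close>

lemma wp_report_prog:
  assumes "valid_pattern P" "rounds_invariant P c s"
    and "nmem s ''ok'' 0 = 1 \<longrightarrow> nmem s ''k'' 0 = nseg P"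
  shows "wp report_prog s (\<lambda>t s'. t \<le> 50 \<and> (\<exists>bs rep. proc_run P c bs rep \<and> holds_output s' bs rep))"
proof -
  let ?k = "nmem s ''k'' 0" and ?bp = "nmem s ''bp''"
  let ?prev = "?bp (?k - 1)"
  let ?bs = "map ?bp [1..<?k]"
  have k: "1 \<le> ?k" "?k \<le> nseg P" and prev: "?prev \<le> region_end P (?k - 1)"
    and run: "\<And>bs rep. proc_from P c ?k ?prev bs rep \<Longrightarrow> proc_run P c (?bs @ bs) rep"
    using assms(2) by (auto simp: rounds_invariant_def Let_def)
  have input: "holds_input s P c" "nmem s ''n'' 0 = len P" "nmem s ''b'' 0 = nseg P"
    and sums: "holds_prefix_sums s P c (len P)"
    using assms(2) by (auto simp: rounds_invariant_def holds_input_def)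
  show ?thesis
  proof (cases "nmem s ''ok'' 0 = 1")
    case True
    then have kb: "?k = nseg P" using assms(3) by simp
    have less: "?prev < len P"
      using prev region_end_less_region_start[OF assms(1) k] kb by (simp add: region_start_def)
    let ?e = "Delta_exp prev_exp (NVar ''n'') (NVar ''b'')"
    let ?s = "s\<lparr>nmem := (nmem s)(''found'' := (nmem s ''found'')(0 := ?k - 1))\<rparr>"
    let ?rep = "Delta P c (?prev + 1) (len P) (thr P ?k) \<le> 0"
    have e: "rval ?e ?s = Delta P c (?prev + 1) (len P) (thr P ?k)"
      using input sums less kb k by (subst rval_Delta_exp) auto
    have "0 \<le> thr P ?k" using assms(1) k by (simp add: valid_pattern_def)
    then have "proc_run P c ?bs ?rep"
      using run[OF proc_from.finish[OF kb]] ED_norm_le_iff_Delta(1)[OF less] by simp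
    then show ?thesis
      unfolding report_prog_def using True e
      by (intro wp_intros conjI exI[of _ ?bs] exI[of _ ?rep])
        (simp_all add: holds_output_def add.commute del: One_nat_def)
  next
    case False
    then have "?k < nseg P" "PS P c ?k ?prev = {}" "nmem s ''ok'' 0 = 0"
      using assms(2) by (auto simp: rounds_invariant_def Let_def)
    moreover from this have "proc_run P c (?bs @ []) False"
      using run proc_from.stop by blast
    ultimately show ?thesis
      unfolding report_prog_def
      by (intro wp_intros) (auto simp: holds_output_def intro!: exI[of _ ?bs] exI[of _ False])
  qed
qed

lemma carries_out_procedure_linear:
  "carries_out_procedure_within (\<lambda>n. 1000 * n)
    (Seq prefix_sums_prog (Seq rounds_prog report_prog))"
  unfolding carries_out_procedure_within_def
proof (intro allI impI, elim conjE)
  fix P c s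
  assume P: "valid_pattern P" and s: "holds_input s P c"
  \<comment> \<open>This absorbs the additive constants of the three phases into the factor
    \<open>1000\<close>.\<close>
  have "1 \<le> len P" using P by (simp add: valid_pattern_def)
  then have "wp (Seq prefix_sums_prog (Seq rounds_prog report_prog)) s
    (\<lambda>t s'. t \<le> 1000 * len P \<and> (\<exists>bs rep. proc_run P c bs rep \<and> holds_output s' bs rep))"
    by (intro wp_Seq wp_mono[OF wp_prefix_sums_prog[OF s]])
      (elim conjE, rule wp_mono[OF wp_rounds_prog[OF P]], assumption+, elim conjE,
        rule wp_mono[OF wp_report_prog[OF P]], assumption+, auto)
  then show "\<exists>t s' bs rep. exec (Seq prefix_sums_prog (Seq rounds_prog report_prog)) s t s' \<and>
      t \<le> 1000 * len P \<and> proc_run P c bs rep \<and> holds_output s' bs rep"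
    unfolding wp_def by blast
qed

theorem mainTheorem3:
  shows "(\<forall>(P :: fg_pattern) (c :: nat \<Rightarrow> real). valid_pattern P \<longrightarrow>
            (\<exists>bs rep. proc_run P c bs rep) \<and>
            (\<forall>bs rep. proc_run P c bs rep \<longrightarrow> (rep \<longleftrightarrow> fine_grained_match P c))) \<and>
         (\<exists>(q :: prog) (K :: nat). carries_out_procedure_within (\<lambda>n. K * n) q)"
proof (intro conjI allI impI)
  fix P :: fg_pattern and c :: "nat \<Rightarrow> real" and bs rep
  assume P: "valid_pattern P"
  show "\<exists>bs rep. proc_run P c bs rep"
    using proc_from_total[of 1 P] P by (simp add: proc_run_def valid_pattern_def)
  show "rep \<longleftrightarrow> fine_grained_match P c" if "proc_run P c bs rep"
    using proc_from_iff_completable[of P c 1 0 bs rep] that P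
    by (simp add: proc_run_def fine_grained_match_iff_completable region_end_def)
qed (use carries_out_procedure_linear in blast)

end
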